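(* (Confluence.) The reduction relation $\to$ of the $\mathcal{L}^{\mathcal S}_2$-calculus described in the context is confluent (on well-formed proof-terms): if $t\to^* u_1$ and $t\to^* u_2$, then there is $v$ with $u_1\to^* v$ and $u_2\to^* v$.
   Context: Let $\mathcal S$ be a semiring. Propositions (modulo $\alpha$-equivalence): $A ::= X \mid \mathbf 1 \mid A\multimap A\mid A\otimes A\mid \top\mid \mathbf 0\mid A\,\&\,A\mid A\oplus A\mid\, !A\mid \forall X.A$. Proof-terms (modulo $\alpha$-equivalence; $a\in\mathcal S$): $t ::= x \mid t\boxplus u\mid a\bullet t\mid a.\star\mid \delta_{\mathbf 1}(t,u)\mid \lambda x^A.t\mid t\,u\mid t\otimes u\mid \delta_\otimes(t,x^Ay^B.u)\mid\langle\rangle\mid \delta_{\mathbf 0}(t) \mid \langle t,u\rangle\mid \delta^1_\&(t,x^A.u)\mid\delta^2_\&(t,x^B.u)\mid \mathrm{inl}(t)\mid\mathrm{inr}(t)\mid\delta_\oplus(t,x^A.u,y^B.v)\mid\, !t\mid\delta_!(t,x^A.u)\mid\Lambda X.t\mid t\,A$, where $\boxplus$ is the proof-term sum and $\bullet$ scalar product; $(u/x)t$ and $(B/X)t$ denote substitutions. One-step reduction $\to$ is the closure under arbitrary proof-term contexts of: $\delta_{\mathbf 1}(a.\star,t)\to a\bullet t$; $(\lambda x^A.t)\,u\to(u/x)t$; $\delta_\otimes(u\otimes v,x^Ay^B.w)\to(u/x,v/y)w$; $\delta^i_\&(\langle t_1,t_2\rangle,x.v)\to(t_i/x)v$ ($i=1,2$);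 $\delta_\oplus(\mathrm{inl}(t),x^A.v,y^B.w)\to(t/x)v$; $\delta_\oplus(\mathrm{inr}(u),x^A.v,y^B.w)\to(u/y)w$; $\delta_!(!t,x^A.u)\to(t/x)u$; $(\Lambda X.t)\,A\to(A/X)t$; $a.\star\boxplus b.\star\to(a+b).\star$; $(\lambda x^A.t)\boxplus(\lambda x^A.u)\to\lambda x^A.(t\boxplus u)$; $\delta_\otimes(t\boxplus u,x^Ay^B.v)\to\delta_\otimes(t,x^Ay^B.v)\boxplus\delta_\otimes(u,x^Ay^B.v)$; $\langle\rangle\boxplus\langle\rangle\to\langle\rangle$; $\langle t,u\rangle\boxplus\langle v,w\rangle\to\langle t\boxplus v,u\boxplus w\rangle$; $\delta_\oplus(t\boxplus u,x^A.v,y^B.w)\to\delta_\oplus(t,x^A.v,y^B.w)\boxplus\delta_\oplus(u,x^A.v,y^B.w)$; $!t\boxplus !u\to !(t\boxplus u)$; $(\Lambda X.t)\boxplus(\Lambda X.u)\to\Lambda X.(t\boxplus u)$; $a\bullet b.\star\to(a\times b).\star$; $a\bullet\lambda x^A.t\to\lambda x^A.a\bullet t$; $\delta_\otimes(a\bullet t,x^Ay^B.v)\to a\bullet\delta_\otimes(t,x^Ay^B.v)$; $a\bullet\langle\rangle\to\langle\rangle$; $a\bullet\langle t,u\rangle\to\langle a\bullet t,a\bullet u\rangle$; $\delta_\oplus(a\bullet t,x^A.v,y^B.w)\to a\bullet\delta_\oplus(t,x^A.v,y^B.w)$; $a\bullet !t\to !(a\bullet t)$; $a\bullet\Lambda X.t\to\Lambda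 X.a\bullet t$. $\to^*$ is the reflexive-transitive closure. *)

theory Defs
  imports Main
begin

text \<open>
  The second-order linear calculus over a semiring of scalars.  Syntax modulo alpha-equivalence
  is represented with de Bruijn indices, so that alpha-equivalence is equality.  There are two
  independent index spaces: one for proposition variables (bound by \<^verbatim>\<open>All\<close> and \<^verbatim>\<open>TLam\<close>) and one
  for proof-term variables.  Indices that exceed the number of enclosing binders are the free
  variables.
\<close>

section \<open>Propositions\<close>

datatype form =
    PVar nat
  | POne
  | Lolli form form
  | Tensor form form
  | PTop
  | PZero
  | With form form
  | Plus form form
  | OfCourse form
  | All form

primrec form_ren :: "(nat \<Rightarrow> nat) \<Rightarrow> form \<Rightarrow> form" where
  "form_ren r (PVar n) = PVar (r n)"
| "form_ren r POne = POne"
| "form_ren r (Lolli A B) = Lolli (form_ren r A) (form_ren r B)"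
| "form_ren r (Tensor A B) = Tensor (form_ren r A) (form_ren r B)"
| "form_ren r PTop = PTop"
| "form_ren r PZero = PZero"
| "form_ren r (With A B) = With (form_ren r A) (form_ren r B)"
| "form_ren r (Plus A B) = Plus (form_ren r A) (form_ren r B)"
| "form_ren r (OfCourse A) = OfCourse (form_ren r A)"
| "form_ren r (All A) = All (form_ren (case_nat 0 (\<lambda>n. Suc (r n))) A)"

text \<open>Moving a proposition below one more proposition binder.\<close>

abbreviation form_shift :: "form \<Rightarrow> form" where
  "form_shift \<equiv> form_ren Suc"

abbreviation form_up :: "(nat \<Rightarrow> form) \<Rightarrow> nat \<Rightarrow> form" where
  "form_up s \<equiv> case_nat (PVar 0) (\<lambda>n. form_shift (s n))"

primrec form_subst :: "(nat \<Rightarrow> form) \<Rightarrow> form \<Rightarrow> form" where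
  "form_subst s (PVar n) = s n"
| "form_subst s POne = POne"
| "form_subst s (Lolli A B) = Lolli (form_subst s A) (form_subst s B)"
| "form_subst s (Tensor A B) = Tensor (form_subst s A) (form_subst s B)"
| "form_subst s PTop = PTop"
| "form_subst s PZero = PZero"
| "form_subst s (With A B) = With (form_subst s A) (form_subst s B)"
| "form_subst s (Plus A B) = Plus (form_subst s A) (form_subst s B)"
| "form_subst s (OfCourse A) = OfCourse (form_subst s A)"
| "form_subst s (All A) = All (form_subst (form_up s) A)"

text \<open>\<^verbatim>\<open>form_inst B A\<close> is \<open>(B/X)A\<close>, where \<open>X\<close> is the variable with index 0 in \<open>A\<close>.\<close>

definition form_inst :: "form \<Rightarrow> form \<Rightarrow> form" where
  "form_inst B A = form_subst (case_nat B PVar) A"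

section \<open>Proof-terms\<close>

text \<open>
  Binders: \<^verbatim>\<open>Lam A t\<close> is \<open>\<lambda>x\<^sup>A. t\<close> with \<open>x\<close> the index 0 of \<open>t\<close>; likewise for the
  one-variable branches of the eliminations.  In \<^verbatim>\<open>ElimTensor t A B u\<close>, which is
  \<open>\<delta>\<^sub>\<otimes>(t, x\<^sup>A y\<^sup>B. u)\<close>, the variable \<open>x\<close> is the index 1 and \<open>y\<close> is the index 0 of \<open>u\<close>.
\<close>

datatype 's trm =
    Var nat
  | Sum "'s trm" "'s trm"
  | Scal 's "'s trm"
  | Star 's
  | ElimOne "'s trm" "'s trm"
  | Lam form "'s trm"
  | App "'s trm" "'s trm"
  | Tens "'s trm" "'s trm"
  | ElimTensor "'s trm" form form "'s trm"
  | Unit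
  | ElimZero "'s trm"
  | Tuple "'s trm" "'s trm"
  | ElimWith1 "'s trm" form "'s trm"
  | ElimWith2 "'s trm" form "'s trm"
  | InL "'s trm"
  | InR "'s trm"
  | ElimPlus "'s trm" form "'s trm" form "'s trm"
  | Bang "'s trm"
  | ElimBang "'s trm" form "'s trm"
  | TLam "'s trm"
  | TApp "'s trm" form

text \<open>Substitution of propositions for proposition variables in a proof-term.\<close>

primrec trm_form_subst :: "(nat \<Rightarrow> form) \<Rightarrow> 's trm \<Rightarrow> 's trm" where
  "trm_form_subst s (Var n) = Var n"
| "trm_form_subst s (Sum t u) = Sum (trm_form_subst s t) (trm_form_subst s u)"
| "trm_form_subst s (Scal a t) = Scal a (trm_form_subst s t)"
| "trm_form_subst s (Star a) = Star a"
| "trm_form_subst s (ElimOne t u) = ElimOne (trm_form_subst s t) (trm_form_subst s u)"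
| "trm_form_subst s (Lam A t) = Lam (form_subst s A) (trm_form_subst s t)"
| "trm_form_subst s (App t u) = App (trm_form_subst s t) (trm_form_subst s u)"
| "trm_form_subst s (Tens t u) = Tens (trm_form_subst s t) (trm_form_subst s u)"
| "trm_form_subst s (ElimTensor t A B u) =
     ElimTensor (trm_form_subst s t) (form_subst s A) (form_subst s B) (trm_form_subst s u)"
| "trm_form_subst s Unit = Unit"
| "trm_form_subst s (ElimZero t) = ElimZero (trm_form_subst s t)"
| "trm_form_subst s (Tuple t u) = Tuple (trm_form_subst s t) (trm_form_subst s u)"
| "trm_form_subst s (ElimWith1 t A u) =
     ElimWith1 (trm_form_subst s t) (form_subst s A) (trm_form_subst s u)"
| "trm_form_subst s (ElimWith2 t B u) =
     ElimWith2 (trm_form_subst s t) (form_subst s B) (trm_form_subst s u)"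
| "trm_form_subst s (InL t) = InL (trm_form_subst s t)"
| "trm_form_subst s (InR t) = InR (trm_form_subst s t)"
| "trm_form_subst s (ElimPlus t A u B v) =
     ElimPlus (trm_form_subst s t) (form_subst s A) (trm_form_subst s u)
       (form_subst s B) (trm_form_subst s v)"
| "trm_form_subst s (Bang t) = Bang (trm_form_subst s t)"
| "trm_form_subst s (ElimBang t A u) =
     ElimBang (trm_form_subst s t) (form_subst s A) (trm_form_subst s u)"
| "trm_form_subst s (TLam t) = TLam (trm_form_subst (form_up s) t)"
| "trm_form_subst s (TApp t A) = TApp (trm_form_subst s t) (form_subst s A)"

abbreviation ren_up :: "(nat \<Rightarrow> nat) \<Rightarrow> nat \<Rightarrow> nat" where
  "ren_up r \<equiv> case_nat 0 (\<lambda>n. Suc (r n))"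

primrec trm_ren :: "(nat \<Rightarrow> nat) \<Rightarrow> 's trm \<Rightarrow> 's trm" where
  "trm_ren r (Var n) = Var (r n)"
| "trm_ren r (Sum t u) = Sum (trm_ren r t) (trm_ren r u)"
| "trm_ren r (Scal a t) = Scal a (trm_ren r t)"
| "trm_ren r (Star a) = Star a"
| "trm_ren r (ElimOne t u) = ElimOne (trm_ren r t) (trm_ren r u)"
| "trm_ren r (Lam A t) = Lam A (trm_ren (ren_up r) t)"
| "trm_ren r (App t u) = App (trm_ren r t) (trm_ren r u)"
| "trm_ren r (Tens t u) = Tens (trm_ren r t) (trm_ren r u)"
| "trm_ren r (ElimTensor t A B u) =
     ElimTensor (trm_ren r t) A B (trm_ren (ren_up (ren_up r)) u)"
| "trm_ren r Unit = Unit"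
| "trm_ren r (ElimZero t) = ElimZero (trm_ren r t)"
| "trm_ren r (Tuple t u) = Tuple (trm_ren r t) (trm_ren r u)"
| "trm_ren r (ElimWith1 t A u) = ElimWith1 (trm_ren r t) A (trm_ren (ren_up r) u)"
| "trm_ren r (ElimWith2 t B u) = ElimWith2 (trm_ren r t) B (trm_ren (ren_up r) u)"
| "trm_ren r (InL t) = InL (trm_ren r t)"
| "trm_ren r (InR t) = InR (trm_ren r t)"
| "trm_ren r (ElimPlus t A u B v) =
     ElimPlus (trm_ren r t) A (trm_ren (ren_up r) u) B (trm_ren (ren_up r) v)"
| "trm_ren r (Bang t) = Bang (trm_ren r t)"
| "trm_ren r (ElimBang t A u) = ElimBang (trm_ren r t) A (trm_ren (ren_up r) u)"
| "trm_ren r (TLam t) = TLam (trm_ren r t)"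
| "trm_ren r (TApp t A) = TApp (trm_ren r t) A"

abbreviation trm_up :: "(nat \<Rightarrow> 's trm) \<Rightarrow> nat \<Rightarrow> 's trm" where
  "trm_up s \<equiv> case_nat (Var 0) (\<lambda>n. trm_ren Suc (s n))"

text \<open>
  Simultaneous capture-avoiding substitution of proof-terms.  Under \<^verbatim>\<open>TLam\<close> the free proposition
  variables of the substituted proof-terms are shifted.
\<close>

primrec trm_subst :: "(nat \<Rightarrow> 's trm) \<Rightarrow> 's trm \<Rightarrow> 's trm" where
  "trm_subst s (Var n) = s n"
| "trm_subst s (Sum t u) = Sum (trm_subst s t) (trm_subst s u)"
| "trm_subst s (Scal a t) = Scal a (trm_subst s t)"
| "trm_subst s (Star a) = Star a"
| "trm_subst s (ElimOne t u) = ElimOne (trm_subst s t) (trm_subst s u)"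
| "trm_subst s (Lam A t) = Lam A (trm_subst (trm_up s) t)"
| "trm_subst s (App t u) = App (trm_subst s t) (trm_subst s u)"
| "trm_subst s (Tens t u) = Tens (trm_subst s t) (trm_subst s u)"
| "trm_subst s (ElimTensor t A B u) =
     ElimTensor (trm_subst s t) A B (trm_subst (trm_up (trm_up s)) u)"
| "trm_subst s Unit = Unit"
| "trm_subst s (ElimZero t) = ElimZero (trm_subst s t)"
| "trm_subst s (Tuple t u) = Tuple (trm_subst s t) (trm_subst s u)"
| "trm_subst s (ElimWith1 t A u) = ElimWith1 (trm_subst s t) A (trm_subst (trm_up s) u)"
| "trm_subst s (ElimWith2 t B u) = ElimWith2 (trm_subst s t) B (trm_subst (trm_up s) u)"
| "trm_subst s (InL t) = InL (trm_subst s t)"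
| "trm_subst s (InR t) = InR (trm_subst s t)"
| "trm_subst s (ElimPlus t A u B v) =
     ElimPlus (trm_subst s t) A (trm_subst (trm_up s) u) B (trm_subst (trm_up s) v)"
| "trm_subst s (Bang t) = Bang (trm_subst s t)"
| "trm_subst s (ElimBang t A u) = ElimBang (trm_subst s t) A (trm_subst (trm_up s) u)"
| "trm_subst s (TLam t) = TLam (trm_subst (\<lambda>n. trm_form_subst (\<lambda>k. PVar (Suc k)) (s n)) t)"
| "trm_subst s (TApp t A) = TApp (trm_subst s t) A"

text \<open>
  \<^verbatim>\<open>inst1 u t\<close> is \<open>(u/x)t\<close> with \<open>x\<close> the index 0; \<^verbatim>\<open>inst2 u v t\<close> is \<open>(u/x, v/y)t\<close> with \<open>x\<close> the
  index 1 and \<open>y\<close> the index 0; \<^verbatim>\<open>inst_form A t\<close> is \<open>(A/X)t\<close> with \<open>X\<close> the index 0.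
\<close>

definition inst1 :: "'s trm \<Rightarrow> 's trm \<Rightarrow> 's trm" where
  "inst1 u t = trm_subst (case_nat u Var) t"

definition inst2 :: "'s trm \<Rightarrow> 's trm \<Rightarrow> 's trm \<Rightarrow> 's trm" where
  "inst2 u v t = trm_subst (case_nat v (case_nat u Var)) t"

definition inst_form :: "form \<Rightarrow> 's trm \<Rightarrow> 's trm" where
  "inst_form A t = trm_form_subst (case_nat A PVar) t"

section \<open>Deduction rules\<close>

text \<open>
  The judgement \<^verbatim>\<open>typed U G t A\<close> has a non-linear context \<^verbatim>\<open>U\<close> and a linear context \<^verbatim>\<open>G\<close>: finite
  partial maps from proof-term variables to propositions, with disjoint domains.  The variable
  bound last is 0, so a binder puts one entry in front of each context: \<^verbatim>\<open>bind A\<close> in the context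
  that receives the variable, \<^verbatim>\<open>skip\<close> in the other one.
\<close>

type_synonym ctx = "nat \<rightharpoonup> form"

definition bind :: "form \<Rightarrow> ctx \<Rightarrow> ctx" where
  "bind A G = case_nat (Some A) G"

definition skip :: "ctx \<Rightarrow> ctx" where
  "skip G = case_nat None G"

definition ctx_shift :: "ctx \<Rightarrow> ctx" where
  "ctx_shift G = (\<lambda>n. map_option form_shift (G n))"

definition ctx_ok :: "ctx \<Rightarrow> ctx \<Rightarrow> bool" where
  "ctx_ok U G \<longleftrightarrow> finite (dom U) \<and> finite (dom G) \<and> dom U \<inter> dom G = {}"

definition disj :: "ctx \<Rightarrow> ctx \<Rightarrow> bool" where
  "disj G D \<longleftrightarrow> dom G \<inter> dom D = {}"

text \<open>
  In \<^verbatim>\<open>all_i\<close> the side condition that \<open>X\<close> is not free in the contexts is expressed by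
  shifting the contexts.
\<close>

inductive typed :: "ctx \<Rightarrow> ctx \<Rightarrow> 's trm \<Rightarrow> form \<Rightarrow> bool" where
  lin_ax: "ctx_ok U [n \<mapsto> A] \<Longrightarrow> typed U [n \<mapsto> A] (Var n) A"
| ax: "ctx_ok U Map.empty \<Longrightarrow> U n = Some A \<Longrightarrow> typed U Map.empty (Var n) A"
| sum: "typed U G t A \<Longrightarrow> typed U G u A \<Longrightarrow> typed U G (Sum t u) A"
| prod: "typed U G t A \<Longrightarrow> typed U G (Scal a t) A"
| one_i: "ctx_ok U Map.empty \<Longrightarrow> typed U Map.empty (Star a) POne"
| one_e: "typed U G t POne \<Longrightarrow> typed U D u A \<Longrightarrow> disj G D \<Longrightarrow> typed U (G ++ D) (ElimOne t u) A"
| lolli_i: "typed (skip U) (bind A G) t B \<Longrightarrow> typed U G (Lam A t) (Lolli A B)"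
| lolli_e: "typed U G t (Lolli A B) \<Longrightarrow> typed U D u A \<Longrightarrow> disj G D \<Longrightarrow>
    typed U (G ++ D) (App t u) B"
| tensor_i: "typed U G t A \<Longrightarrow> typed U D u B \<Longrightarrow> disj G D \<Longrightarrow>
    typed U (G ++ D) (Tens t u) (Tensor A B)"
| tensor_e: "typed U G t (Tensor A B) \<Longrightarrow> typed (skip (skip U)) (bind B (bind A D)) u C \<Longrightarrow>
    disj G D \<Longrightarrow> typed U (G ++ D) (ElimTensor t A B u) C"
| top_i: "ctx_ok U G \<Longrightarrow> typed U G Unit PTop"
| zero_e: "typed U G t PZero \<Longrightarrow> disj G D \<Longrightarrow> ctx_ok U (G ++ D) \<Longrightarrow>
    typed U (G ++ D) (ElimZero t) C"
| with_i: "typed U G t A \<Longrightarrow> typed U G u B \<Longrightarrow> typed U G (Tuple t u) (With A B)"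
| with_e1: "typed U G t (With A B) \<Longrightarrow> typed (skip U) (bind A D) u C \<Longrightarrow> disj G D \<Longrightarrow>
    typed U (G ++ D) (ElimWith1 t A u) C"
| with_e2: "typed U G t (With A B) \<Longrightarrow> typed (skip U) (bind B D) u C \<Longrightarrow> disj G D \<Longrightarrow>
    typed U (G ++ D) (ElimWith2 t B u) C"
| plus_i1: "typed U G t A \<Longrightarrow> typed U G (InL t) (Plus A B)"
| plus_i2: "typed U G t B \<Longrightarrow> typed U G (InR t) (Plus A B)"
| plus_e: "typed U G t (Plus A B) \<Longrightarrow> typed (skip U) (bind A D) u C \<Longrightarrow>
    typed (skip U) (bind B D) v C \<Longrightarrow> disj G D \<Longrightarrow> typed U (G ++ D) (ElimPlus t A u B v) C"
| bang_i: "typed U Map.empty t A \<Longrightarrow> typed U Map.empty (Bang t) (OfCourse A)"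
| bang_e: "typed U G t (OfCourse A) \<Longrightarrow> typed (bind A U) (skip D) u B \<Longrightarrow> disj G D \<Longrightarrow>
    typed U (G ++ D) (ElimBang t A u) B"
| all_i: "typed (ctx_shift U) (ctx_shift G) t A \<Longrightarrow> typed U G (TLam t) (All A)"
| all_e: "typed U G t (All A) \<Longrightarrow> typed U G (TApp t B) (form_inst B A)"

definition well_formed :: "'s trm \<Rightarrow> bool" where
  "well_formed t \<longleftrightarrow> (\<exists>U G A. typed U G t A)"

section \<open>Reduction\<close>

text \<open>
  The sort \<open>{semiring_0, monoid_mult}\<close> is that of semirings with 0 and 1 in which 0 = 1 is
  allowed, in contrast to the class \<open>semiring_1\<close>.
\<close>

inductive root_step :: "'s::{semiring_0, monoid_mult} trm \<Rightarrow> 's trm \<Rightarrow> bool" where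
  "root_step (ElimOne (Star a) t) (Scal a t)"
| "root_step (App (Lam A t) u) (inst1 u t)"
| "root_step (ElimTensor (Tens u v) A B w) (inst2 u v w)"
| "root_step (ElimWith1 (Tuple t1 t2) A v) (inst1 t1 v)"
| "root_step (ElimWith2 (Tuple t1 t2) B v) (inst1 t2 v)"
| "root_step (ElimPlus (InL t) A v B w) (inst1 t v)"
| "root_step (ElimPlus (InR u) A v B w) (inst1 u w)"
| "root_step (ElimBang (Bang t) A u) (inst1 t u)"
| "root_step (TApp (TLam t) A) (inst_form A t)"
| "root_step (Sum (Star a) (Star b)) (Star (a + b))"
| "root_step (Sum (Lam A t) (Lam A u)) (Lam A (Sum t u))"
| "root_step (ElimTensor (Sum t u) A B v) (Sum (ElimTensor t A B v) (ElimTensor u A B v))"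
| "root_step (Sum Unit Unit) Unit"
| "root_step (Sum (Tuple t u) (Tuple v w)) (Tuple (Sum t v) (Sum u w))"
| "root_step (ElimPlus (Sum t u) A v B w) (Sum (ElimPlus t A v B w) (ElimPlus u A v B w))"
| "root_step (Sum (Bang t) (Bang u)) (Bang (Sum t u))"
| "root_step (Sum (TLam t) (TLam u)) (TLam (Sum t u))"
| "root_step (Scal a (Star b)) (Star (a * b))"
| "root_step (Scal a (Lam A t)) (Lam A (Scal a t))"
| "root_step (ElimTensor (Scal a t) A B v) (Scal a (ElimTensor t A B v))"
| "root_step (Scal a Unit) Unit"
| "root_step (Scal a (Tuple t u)) (Tuple (Scal a t) (Scal a u))"
| "root_step (ElimPlus (Scal a t) A v B w) (Scal a (ElimPlus t A v B w))"
| "root_step (Scal a (Bang t)) (Bang (Scal a t))"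
| "root_step (Scal a (TLam t)) (TLam (Scal a t))"

inductive step :: "'s::{semiring_0, monoid_mult} trm \<Rightarrow> 's trm \<Rightarrow> bool" where
  root: "root_step t t' \<Longrightarrow> step t t'"
| "step t t' \<Longrightarrow> step (Sum t u) (Sum t' u)"
| "step u u' \<Longrightarrow> step (Sum t u) (Sum t u')"
| "step t t' \<Longrightarrow> step (Scal a t) (Scal a t')"
| "step t t' \<Longrightarrow> step (ElimOne t u) (ElimOne t' u)"
| "step u u' \<Longrightarrow> step (ElimOne t u) (ElimOne t u')"
| "step t t' \<Longrightarrow> step (Lam A t) (Lam A t')"
| "step t t' \<Longrightarrow> step (App t u) (App t' u)"
| "step u u' \<Longrightarrow> step (App t u) (App t u')"
| "step t t' \<Longrightarrow> step (Tens t u) (Tens t' u)"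
| "step u u' \<Longrightarrow> step (Tens t u) (Tens t u')"
| "step t t' \<Longrightarrow> step (ElimTensor t A B u) (ElimTensor t' A B u)"
| "step u u' \<Longrightarrow> step (ElimTensor t A B u) (ElimTensor t A B u')"
| "step t t' \<Longrightarrow> step (ElimZero t) (ElimZero t')"
| "step t t' \<Longrightarrow> step (Tuple t u) (Tuple t' u)"
| "step u u' \<Longrightarrow> step (Tuple t u) (Tuple t u')"
| "step t t' \<Longrightarrow> step (ElimWith1 t A u) (ElimWith1 t' A u)"
| "step u u' \<Longrightarrow> step (ElimWith1 t A u) (ElimWith1 t A u')"
| "step t t' \<Longrightarrow> step (ElimWith2 t B u) (ElimWith2 t' B u)"
| "step u u' \<Longrightarrow> step (ElimWith2 t B u) (ElimWith2 t B u')"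
| "step t t' \<Longrightarrow> step (InL t) (InL t')"
| "step t t' \<Longrightarrow> step (InR t) (InR t')"
| "step t t' \<Longrightarrow> step (ElimPlus t A u B v) (ElimPlus t' A u B v)"
| "step u u' \<Longrightarrow> step (ElimPlus t A u B v) (ElimPlus t A u' B v)"
| "step v v' \<Longrightarrow> step (ElimPlus t A u B v) (ElimPlus t A u B v')"
| "step t t' \<Longrightarrow> step (Bang t) (Bang t')"
| "step t t' \<Longrightarrow> step (ElimBang t A u) (ElimBang t' A u)"
| "step u u' \<Longrightarrow> step (ElimBang t A u) (ElimBang t A u')"
| "step t t' \<Longrightarrow> step (TLam t) (TLam t')"
| "step t t' \<Longrightarrow> step (TApp t A) (TApp t' A)"

end

theory Submission
  imports Defs
begin

text \<open>
  The reduction rules have no critical pairs except those between a commutation rule such as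
  \<open>\<delta>\<^sub>\<otimes>(t \<boxplus> u, x y. v) \<rightarrow> \<delta>\<^sub>\<otimes>(t, x y. v) \<boxplus> \<delta>\<^sub>\<otimes>(u, x y. v)\<close> and a contraction of the inner sum or
  scalar product.  In a typable term the latter has a tensor or plus type, for which there is no such
  contraction.  So on typable terms, which are closed under reduction, the system behaves like an
  orthogonal one: all parallel reducts of a term have a common parallel reduct, which is obtained by
  contracting all redexes at once.
\<close>

section \<open>Substitution\<close>

text \<open>
  The weak congruence rule would keep the simplifier out of the branches of \<^const>\<open>case_nat\<close>, where
  nested liftings have to be rewritten.
\<close>

declare nat.case_cong_weak [cong del]

section \<open>Renaming and substitution in propositions\<close>

lemma form_up_ren: "form_up s (ren_up r n) = form_up (\<lambda>n. s (r n)) n"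
  by (simp split: nat.split)

text \<open>In the case \<open>All\<close> the induction hypothesis produces a composition of two
  lifted maps under a \<lambda>. The accompanying laws on lifting are therefore stated at a point
  \<open>n\<close>, where they can rewrite it.\<close>

lemma form_subst_ren: "form_subst s (form_ren r A) = form_subst (\<lambda>n. s (r n)) A"
  by (induction A arbitrary: s r) (simp_all add: form_up_ren)

lemma ren_up_ren_up: "ren_up r (ren_up r' n) = ren_up (\<lambda>n. r (r' n)) n"
  by (simp split: nat.split)

lemma form_ren_ren: "form_ren r (form_ren r' A) = form_ren (\<lambda>n. r (r' n)) A"
  by (induction A arbitrary: r r') (simp_all add: ren_up_ren_up)

lemma form_ren_up: "form_ren (ren_up r) (form_up s n) = form_up (\<lambda>n. form_ren r (s n)) n"
  by (simp add: form_ren_ren split: nat.split)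

lemma form_ren_subst: "form_ren r (form_subst s A) = form_subst (\<lambda>n. form_ren r (s n)) A"
  by (induction A arbitrary: r s) (simp_all add: form_ren_up)

lemma form_subst_up: "form_subst (form_up s) (form_up s' n) = form_up (\<lambda>n. form_subst s (s' n)) n"
  by (simp add: form_subst_ren form_ren_subst split: nat.split)

lemma form_subst_subst: "form_subst s (form_subst s' A) = form_subst (\<lambda>n. form_subst s (s' n)) A"
  by (induction A arbitrary: s s') (simp_all add: form_subst_up)

text \<open>Turns a lifted identity back into an identity, as the identity laws need below
  binders.\<close>

lemma case_nat_eta [simp]: "case_nat (f 0) (\<lambda>n. f (Suc n)) = f"
  by (simp add: fun_eq_iff split: nat.split)

lemma form_subst_PVar [simp]: "form_subst PVar A = A"
  by (induction A) simp_all

lemma form_ren_eq_subst: "form_ren r A = form_subst (\<lambda>n. PVar (r n)) A"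
  using form_subst_ren[of PVar r A] by simp

lemma form_subst_inst:
  "form_subst s (form_inst B A) = form_inst (form_subst s B) (form_subst (form_up s) A)"
proof -
  \<comment> \<open>At a successor, the instantiation on the right undoes the shift made by
    \<open>form_up s\<close>.\<close>
  have "(\<lambda>n. form_subst s (case_nat B PVar n)) =
      (\<lambda>n. form_subst (case_nat (form_subst s B) PVar) (form_up s n))"
    by (auto simp: fun_eq_iff form_subst_ren split: nat.split)
  then show ?thesis by (simp add: form_inst_def form_subst_subst)
qed

section \<open>Renaming and both substitutions in proof-terms\<close>

lemma trm_form_subst_trm_form_subst:
  "trm_form_subst s (trm_form_subst s' t) = trm_form_subst (\<lambda>n. form_subst s (s' n)) t"
  by (induction t arbitrary: s s') (simp_all add: form_subst_subst form_subst_up)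

lemma trm_form_subst_PVar [simp]: "trm_form_subst PVar t = t"
  by (induction t) simp_all

lemma trm_form_subst_ren: "trm_form_subst s (trm_ren r t) = trm_ren r (trm_form_subst s t)"
  by (induction t arbitrary: s r) simp_all

lemma trm_up_ren: "trm_up s (ren_up r n) = trm_up (\<lambda>n. s (r n)) n"
  by (simp split: nat.split)

lemma trm_subst_ren: "trm_subst s (trm_ren r t) = trm_subst (\<lambda>n. s (r n)) t"
  by (induction t arbitrary: s r) (simp_all add: trm_up_ren)

lemma trm_ren_ren: "trm_ren r (trm_ren r' t) = trm_ren (\<lambda>n. r (r' n)) t"
  by (induction t arbitrary: r r') (simp_all add: ren_up_ren_up)

lemma trm_ren_up: "trm_ren (ren_up r) (trm_up s n) = trm_up (\<lambda>n. trm_ren r (s n)) n"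
  by (simp add: trm_ren_ren split: nat.split)

lemma trm_ren_subst: "trm_ren r (trm_subst s t) = trm_subst (\<lambda>n. trm_ren r (s n)) t"
  by (induction t arbitrary: r s) (simp_all add: trm_ren_up trm_form_subst_ren)

lemma trm_form_subst_up: "trm_form_subst f (trm_up s n) = trm_up (\<lambda>n. trm_form_subst f (s n)) n"
  by (simp add: trm_form_subst_ren split: nat.split)

text \<open>Needed in the case \<open>TLam\<close>, where the images of a term substitution are
  shifted below the proposition binder.\<close>

lemma trm_form_subst_shift:
  "trm_form_subst (form_up f) (trm_form_subst (\<lambda>k. PVar (Suc k)) t) =
   trm_form_subst (\<lambda>k. PVar (Suc k)) (trm_form_subst f t)"
  by (simp add: trm_form_subst_trm_form_subst form_ren_eq_subst)

lemma trm_form_subst_subst: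
  "trm_form_subst f (trm_subst s t) = trm_subst (\<lambda>n. trm_form_subst f (s n)) (trm_form_subst f t)"
  by (induction t arbitrary: f s) (simp_all add: trm_form_subst_up trm_form_subst_shift)

lemma trm_subst_up: "trm_subst (trm_up s) (trm_up s' n) = trm_up (\<lambda>n. trm_subst s (s' n)) n"
  by (simp add: trm_subst_ren trm_ren_subst split: nat.split)

lemma trm_subst_subst: "trm_subst s (trm_subst s' t) = trm_subst (\<lambda>n. trm_subst s (s' n)) t"
  by (induction t arbitrary: s s') (simp_all add: trm_subst_up trm_form_subst_subst)

lemma trm_subst_Var [simp]: "trm_subst Var t = t"
  by (induction t) simp_all

section \<open>Instantiation commutes with renaming and substitution\<close>

lemma trm_ren_inst1: "trm_ren r (inst1 u t) = inst1 (trm_ren r u) (trm_ren (ren_up r) t)"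
  unfolding inst1_def trm_ren_subst trm_subst_ren
  by (rule arg_cong[where f = "\<lambda>s. trm_subst s t"]) (auto simp: fun_eq_iff split: nat.split)

lemma trm_ren_inst2:
  "trm_ren r (inst2 u v t) = inst2 (trm_ren r u) (trm_ren r v) (trm_ren (ren_up (ren_up r)) t)"
  unfolding inst2_def trm_ren_subst trm_subst_ren
  by (rule arg_cong[where f = "\<lambda>s. trm_subst s t"]) (auto simp: fun_eq_iff split: nat.split)

lemma trm_ren_inst_form: "trm_ren r (inst_form A t) = inst_form A (trm_ren r t)"
  by (simp add: inst_form_def trm_form_subst_ren)

lemma trm_subst_inst1: "trm_subst s (inst1 u t) = inst1 (trm_subst s u) (trm_subst (trm_up s) t)"
  unfolding inst1_def trm_subst_subst
  by (rule arg_cong[where f = "\<lambda>s. trm_subst s t"])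
    (auto simp: fun_eq_iff trm_subst_ren split: nat.split)

lemma trm_subst_inst2:
  "trm_subst s (inst2 u v t) = inst2 (trm_subst s u) (trm_subst s v) (trm_subst (trm_up (trm_up s)) t)"
  unfolding inst2_def trm_subst_subst
  by (rule arg_cong[where f = "\<lambda>s. trm_subst s t"])
    (auto simp: fun_eq_iff trm_subst_ren split: nat.split)

text \<open>The body \<open>t\<close> lies below the proposition binder, so the images of
  \<open>s\<close> enter it shifted; instantiating by \<open>A\<close> removes the shift
  again.\<close>

lemma trm_subst_inst_form:
  "trm_subst s (inst_form A t) =
   inst_form A (trm_subst (\<lambda>n. trm_form_subst (\<lambda>k. PVar (Suc k)) (s n)) t)"
  by (simp add: inst_form_def trm_form_subst_subst trm_form_subst_trm_form_subst)

lemma trm_form_subst_inst1: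
  "trm_form_subst f (inst1 u t) = inst1 (trm_form_subst f u) (trm_form_subst f t)"
  unfolding inst1_def trm_form_subst_subst
  by (rule arg_cong[where f = "\<lambda>s. trm_subst s _"]) (auto simp: fun_eq_iff split: nat.split)

lemma trm_form_subst_inst2:
  "trm_form_subst f (inst2 u v t) =
   inst2 (trm_form_subst f u) (trm_form_subst f v) (trm_form_subst f t)"
  unfolding inst2_def trm_form_subst_subst
  by (rule arg_cong[where f = "\<lambda>s. trm_subst s _"]) (auto simp: fun_eq_iff split: nat.split)

lemma trm_form_subst_inst_form:
  "trm_form_subst f (inst_form A t) =
   inst_form (form_subst f A) (trm_form_subst (form_up f) t)"
  unfolding inst_form_def trm_form_subst_trm_form_subst
  by (rule arg_cong[where f = "\<lambda>s. trm_form_subst s t"])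
    (auto simp: fun_eq_iff form_subst_ren split: nat.split)

section \<open>Typing without linearity\<close>

text \<open>
  Only the shape of types matters for confluence, so resources are forgotten: the context is total,
  and weakening and contraction are built in.
\<close>

inductive has_ty :: "(nat \<Rightarrow> form) \<Rightarrow> 's trm \<Rightarrow> form \<Rightarrow> bool" where
  "G n = A \<Longrightarrow> has_ty G (Var n) A"
| "has_ty G t A \<Longrightarrow> has_ty G u A \<Longrightarrow> has_ty G (Sum t u) A"
| "has_ty G t A \<Longrightarrow> has_ty G (Scal a t) A"
| "has_ty G (Star a) POne"
| "has_ty G t POne \<Longrightarrow> has_ty G u A \<Longrightarrow> has_ty G (ElimOne t u) A"
| "has_ty (case_nat A G) t B \<Longrightarrow> has_ty G (Lam A t) (Lolli A B)"
| "has_ty G t (Lolli A B) \<Longrightarrow> has_ty G u A \<Longrightarrow> has_ty G (App t u) B"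
| "has_ty G t A \<Longrightarrow> has_ty G u B \<Longrightarrow> has_ty G (Tens t u) (Tensor A B)"
| "has_ty G t (Tensor A B) \<Longrightarrow> has_ty (case_nat B (case_nat A G)) u C \<Longrightarrow>
    has_ty G (ElimTensor t A B u) C"
| "has_ty G Unit PTop"
| "has_ty G t PZero \<Longrightarrow> has_ty G (ElimZero t) C"
| "has_ty G t A \<Longrightarrow> has_ty G u B \<Longrightarrow> has_ty G (Tuple t u) (With A B)"
| "has_ty G t (With A B) \<Longrightarrow> has_ty (case_nat A G) u C \<Longrightarrow> has_ty G (ElimWith1 t A u) C"
| "has_ty G t (With A B) \<Longrightarrow> has_ty (case_nat B G) u C \<Longrightarrow> has_ty G (ElimWith2 t B u) C"
| "has_ty G t A \<Longrightarrow> has_ty G (InL t) (Plus A B)"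
| "has_ty G t B \<Longrightarrow> has_ty G (InR t) (Plus A B)"
| "has_ty G t (Plus A B) \<Longrightarrow> has_ty (case_nat A G) u C \<Longrightarrow> has_ty (case_nat B G) v C \<Longrightarrow>
    has_ty G (ElimPlus t A u B v) C"
| "has_ty G t A \<Longrightarrow> has_ty G (Bang t) (OfCourse A)"
| "has_ty G t (OfCourse A) \<Longrightarrow> has_ty (case_nat A G) u B \<Longrightarrow> has_ty G (ElimBang t A u) B"
| "has_ty (\<lambda>n. form_shift (G n)) t A \<Longrightarrow> has_ty G (TLam t) (All A)"
| "has_ty G t (All A) \<Longrightarrow> C = form_inst B A \<Longrightarrow> has_ty G (TApp t B) C"

inductive_cases has_ty_elims:
  "has_ty G (Sum t u) A"
  "has_ty G (Scal a t) A"
  "has_ty G (Star a) A"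
  "has_ty G (ElimOne t u) A"
  "has_ty G (Lam B t) A"
  "has_ty G (App t u) A"
  "has_ty G (Tens t u) A"
  "has_ty G (ElimTensor t B C u) A"
  "has_ty G (Unit) A"
  "has_ty G (ElimZero t) A"
  "has_ty G (Tuple t u) A"
  "has_ty G (ElimWith1 t B u) A"
  "has_ty G (ElimWith2 t B u) A"
  "has_ty G (InL t) A"
  "has_ty G (InR t) A"
  "has_ty G (ElimPlus t B u C v) A"
  "has_ty G (Bang t) A"
  "has_ty G (ElimBang t B u) A"
  "has_ty G (TLam t) A"
  "has_ty G (TApp t B) A"

section \<open>From linear contexts to one total context\<close>

definition fits :: "(nat \<Rightarrow> form) \<Rightarrow> ctx \<Rightarrow> ctx \<Rightarrow> bool" where
  "fits H U G \<longleftrightarrow> (\<forall>n B. U n = Some B \<or> G n = Some B \<longrightarrow> H n = B)"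

text \<open>The map \<open>++\<close> prefers its right argument; disjointness ensures that no entry
  of \<open>G\<close> is hidden.\<close>

lemma fits_add [simp]: "disj G D \<Longrightarrow> fits H U (G ++ D) \<longleftrightarrow> fits H U G \<and> fits H U D"
  unfolding fits_def disj_def map_add_Some_iff by blast

lemma fits_bind [simp]:
  "fits H U G \<Longrightarrow> fits (case_nat A H) (skip U) (bind A G)"
  "fits H U G \<Longrightarrow> fits (case_nat A H) (bind A U) (skip G)"
  by (auto simp: fits_def bind_def skip_def split: nat.splits)

lemma fits_ctx_shift [simp]:
  "fits H U G \<Longrightarrow> fits (\<lambda>n. form_shift (H n)) (ctx_shift U) (ctx_shift G)"
  by (auto simp: fits_def ctx_shift_def)

lemma disj_fits:
  assumes "disj U G"
  obtains H where "fits H U G"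
proof
  \<comment> \<open>Indices in neither context receive the unspecified value
    \<open>the None\<close>.\<close>
  show "fits (\<lambda>n. the ((U ++ G) n)) U G"
    using assms by (auto simp: fits_def disj_def map_add_def split: option.split)
qed

lemma disj_bind [simp]:
  "disj (skip U) (bind A G) \<longleftrightarrow> disj U G" "disj (bind A U) (skip G) \<longleftrightarrow> disj U G"
proof -
  have disj_iff: "disj U G \<longleftrightarrow> (\<forall>n. U n = None \<or> G n = None)" for U G
    by (simp add: disj_def disjoint_iff domIff imp_conv_disj del: not_None_eq)
  have all_nat: "(\<forall>n. P n) \<longleftrightarrow> P 0 \<and> (\<forall>n. P (Suc n))" for P
    by (metis nat.exhaust)
  show "disj (skip U) (bind A G) \<longleftrightarrow> disj U G" "disj (bind A U) (skip G) \<longleftrightarrow> disj U G"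
    unfolding disj_iff by (subst (1) all_nat, simp add: bind_def skip_def)+
qed

lemma disj_ctx_shift [simp]: "disj (ctx_shift U) (ctx_shift G) \<longleftrightarrow> disj U G"
  by (simp add: disj_def dom_def ctx_shift_def)

text \<open>Disjointness is what lets one total context agree with both zones. It starts from
  \<open>ctx_ok\<close> at the leaves, and each term binder adds its index to one zone only.\<close>

lemma typed_disjoint: "typed U G t A \<Longrightarrow> disj U G"
  by (induction rule: typed.induct) (simp_all, auto simp: disj_def ctx_ok_def split: if_splits)

lemma typed_imp_has_ty: "typed U G t A \<Longrightarrow> fits H U G \<Longrightarrow> has_ty H t A"
proof (induction arbitrary: H rule: typed.induct)
  case (lin_ax U n A)
  then show ?case by (simp add: fits_def has_ty.intros)
next
  case (ax U n A)
  then show ?case by (simp add: fits_def has_ty.intros)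
qed (simp?, blast intro: has_ty.intros fits_bind fits_ctx_shift)+

section \<open>Typing under substitution, and subject reduction\<close>

lemma case_nat_map: "(\<lambda>n. f (case_nat x g n)) = case_nat (f x) (\<lambda>n. f (g n))"
  by (simp add: fun_eq_iff split: nat.split)

text \<open>Serves both for shifting below a proposition binder and for contracting
  \<open>TApp (TLam t) B\<close>.\<close>

lemma has_ty_form_subst:
  "has_ty G t A \<Longrightarrow> has_ty (\<lambda>n. form_subst s (G n)) (trm_form_subst s t) (form_subst s A)"
proof (induction arbitrary: s rule: has_ty.induct)
  case (20 G t A)
  show ?case
    \<comment> \<open>The lifted substitution commutes with the shift of the context below
      \<open>TLam\<close>.\<close>
    using "20.IH"[of "form_up s"]
    by (auto intro!: has_ty.intros simp: form_subst_ren form_ren_subst)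
next
  case (21 G t A C B)
  then show ?case by (auto intro!: has_ty.intros(21) simp: form_subst_inst)
next
  case (13 G t A B u C)
  then show ?case by (auto simp: case_nat_map intro!: has_ty.intros(13))
next
  case (14 G t A B u C)
  then show ?case by (auto simp: case_nat_map intro!: has_ty.intros(14))
qed (simp_all add: case_nat_map has_ty.intros, (blast intro: has_ty.intros)+)

lemma has_ty_form_ren:
  "has_ty G t A \<Longrightarrow>
   has_ty (\<lambda>n. form_shift (G n)) (trm_form_subst (\<lambda>k. PVar (Suc k)) t) (form_shift A)"
  using has_ty_form_subst[of G t A "\<lambda>k. PVar (Suc k)"] by (simp add: form_ren_eq_subst)

definition ren_ty :: "(nat \<Rightarrow> form) \<Rightarrow> (nat \<Rightarrow> nat) \<Rightarrow> (nat \<Rightarrow> form) \<Rightarrow> bool" where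
  "ren_ty H r G \<longleftrightarrow> (\<forall>n. H (r n) = G n)"

lemma ren_ty_up: "ren_ty H r G \<Longrightarrow> ren_ty (case_nat A H) (ren_up r) (case_nat A G)"
  by (simp add: ren_ty_def split: nat.split)

lemma ren_ty_shift: "ren_ty H r G \<Longrightarrow> ren_ty (\<lambda>n. form_shift (H n)) r (\<lambda>n. form_shift (G n))"
  by (simp add: ren_ty_def)

lemma has_ty_ren: "has_ty G t A \<Longrightarrow> ren_ty H r G \<Longrightarrow> has_ty H (trm_ren r t) A"
proof (induction arbitrary: H r rule: has_ty.induct)
  case (1 G n A)
  then show ?case by (simp add: ren_ty_def has_ty.intros)
qed (simp only: trm_ren.simps, blast intro: has_ty.intros ren_ty_up ren_ty_shift)+

definition subst_ty :: "(nat \<Rightarrow> form) \<Rightarrow> (nat \<Rightarrow> 's trm) \<Rightarrow> (nat \<Rightarrow> form) \<Rightarrow> bool" where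
  "subst_ty H s G \<longleftrightarrow> (\<forall>n. has_ty H (s n) (G n))"

text \<open>Lifting renames the images of \<open>s\<close>, so stability of typing under renaming
  has to come first.\<close>

lemma subst_ty_up: "subst_ty H s G \<Longrightarrow> subst_ty (case_nat A H) (trm_up s) (case_nat A G)"
  by (auto simp: subst_ty_def ren_ty_def intro: has_ty.intros has_ty_ren[where G = H]
      split: nat.split)

lemma subst_ty_shift:
  "subst_ty H s G \<Longrightarrow>
   subst_ty (\<lambda>n. form_shift (H n)) (\<lambda>n. trm_form_subst (\<lambda>k. PVar (Suc k)) (s n))
     (\<lambda>n. form_shift (G n))"
  by (simp add: subst_ty_def has_ty_form_ren)

lemma has_ty_subst: "has_ty G t A \<Longrightarrow> subst_ty H s G \<Longrightarrow> has_ty H (trm_subst s t) A"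
proof (induction arbitrary: H s rule: has_ty.induct)
  case (1 G n A)
  then show ?case by (auto simp: subst_ty_def)
qed (simp only: trm_subst.simps, blast intro: has_ty.intros subst_ty_up subst_ty_shift)+

lemma has_ty_inst1:
  assumes "has_ty G u A" "has_ty (case_nat A G) t B"
  shows "has_ty G (inst1 u t) B"
  unfolding inst1_def
  by (rule has_ty_subst[OF assms(2)]) (auto simp: subst_ty_def intro: has_ty.intros assms split: nat.split)

lemma has_ty_inst2:
  assumes "has_ty G u A" "has_ty G v B" "has_ty (case_nat B (case_nat A G)) t C"
  shows "has_ty G (inst2 u v t) C"
  unfolding inst2_def
  by (rule has_ty_subst[OF assms(3)]) (auto simp: subst_ty_def intro: has_ty.intros assms split: nat.split)

lemma has_ty_inst_form:
  assumes "has_ty (\<lambda>n. form_shift (G n)) t A"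
  shows "has_ty G (inst_form B t) (form_inst B A)"
  using has_ty_form_subst[OF assms, of "case_nat B PVar"]
  by (simp add: inst_form_def form_inst_def form_subst_ren)

lemma has_ty_root_step: "root_step t t' \<Longrightarrow> has_ty G t A \<Longrightarrow> has_ty G t' A"
  by (induction rule: root_step.induct)
    (auto elim!: has_ty_elims intro: has_ty.intros has_ty_inst1 has_ty_inst2 has_ty_inst_form)

text \<open>Subject reduction: typability persists along all the reductions considered for
  confluence.\<close>

lemma has_ty_step: "step t t' \<Longrightarrow> has_ty G t A \<Longrightarrow> has_ty G t' A"
proof (induction arbitrary: G A rule: step.induct)
  case (root t t')
  then show ?case by (rule has_ty_root_step)
qed (auto elim!: has_ty_elims intro: has_ty.intros)

section \<open>Parallel reduction\<close>

text \<open>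
  A parallel step contracts a redex at the root only if it was there before the subterms were
  reduced; this is why \<^verbatim>\<open>par_root\<close> below asks for \<^verbatim>\<open>redex t\<close> and not just for \<^verbatim>\<open>root_step t' u\<close>.
\<close>

inductive layer :: "('s trm \<Rightarrow> 's trm \<Rightarrow> bool) \<Rightarrow> 's trm \<Rightarrow> 's trm \<Rightarrow> bool" for R where
  "layer R (Var n) (Var n)"
| "R t t' \<Longrightarrow> R u u' \<Longrightarrow> layer R (Sum t u) (Sum t' u')"
| "R t t' \<Longrightarrow> layer R (Scal a t) (Scal a t')"
| "layer R (Star a) (Star a)"
| "R t t' \<Longrightarrow> R u u' \<Longrightarrow> layer R (ElimOne t u) (ElimOne t' u')"
| "R t t' \<Longrightarrow> layer R (Lam A t) (Lam A t')"
| "R t t' \<Longrightarrow> R u u' \<Longrightarrow> layer R (App t u) (App t' u')"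
| "R t t' \<Longrightarrow> R u u' \<Longrightarrow> layer R (Tens t u) (Tens t' u')"
| "R t t' \<Longrightarrow> R u u' \<Longrightarrow> layer R (ElimTensor t A B u) (ElimTensor t' A B u')"
| "layer R Unit Unit"
| "R t t' \<Longrightarrow> layer R (ElimZero t) (ElimZero t')"
| "R t t' \<Longrightarrow> R u u' \<Longrightarrow> layer R (Tuple t u) (Tuple t' u')"
| "R t t' \<Longrightarrow> R u u' \<Longrightarrow> layer R (ElimWith1 t A u) (ElimWith1 t' A u')"
| "R t t' \<Longrightarrow> R u u' \<Longrightarrow> layer R (ElimWith2 t A u) (ElimWith2 t' A u')"
| "R t t' \<Longrightarrow> layer R (InL t) (InL t')"
| "R t t' \<Longrightarrow> layer R (InR t) (InR t')"
| "R t t' \<Longrightarrow> R u u' \<Longrightarrow> R v v' \<Longrightarrow> layer R (ElimPlus t A u B v) (ElimPlus t' A u' B v')"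
| "R t t' \<Longrightarrow> layer R (Bang t) (Bang t')"
| "R t t' \<Longrightarrow> R u u' \<Longrightarrow> layer R (ElimBang t A u) (ElimBang t' A u')"
| "R t t' \<Longrightarrow> layer R (TLam t) (TLam t')"
| "R t t' \<Longrightarrow> layer R (TApp t A) (TApp t' A)"

inductive_cases layer_elims:
  "layer R (Var n) x"
  "layer R (Sum t u) x"
  "layer R (Scal a t) x"
  "layer R (Star a) x"
  "layer R (ElimOne t u) x"
  "layer R (Lam A t) x"
  "layer R (App t u) x"
  "layer R (Tens t u) x"
  "layer R (ElimTensor t A B u) x"
  "layer R Unit x"
  "layer R (ElimZero t) x"
  "layer R (Tuple t u) x"
  "layer R (ElimWith1 t A u) x"
  "layer R (ElimWith2 t A u) x"
  "layer R (InL t) x"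
  "layer R (InR t) x"
  "layer R (ElimPlus t A u B v) x"
  "layer R (Bang t) x"
  "layer R (ElimBang t A u) x"
  "layer R (TLam t) x"
  "layer R (TApp t A) x"

text \<open>Makes \<open>layer par\<close> admissible in the inductive definition of
  \<open>par\<close>, and later extracts single components from its induction hypotheses.\<close>

lemma layer_mono [mono]: "(\<And>x y. R x y \<longrightarrow> S x y) \<Longrightarrow> layer R t t' \<longrightarrow> layer S t t'"
  by (auto elim!: layer.cases intro: layer.intros)

lemma layer_refl: "(\<And>x. R x x) \<Longrightarrow> layer R t t"
  by (cases t) (auto intro: layer.intros)

definition redex :: "'s::{semiring_0, monoid_mult} trm \<Rightarrow> bool" where
  "redex t \<longleftrightarrow> (\<exists>t'. root_step t t')"

lemma redexI: "root_step t t' \<Longrightarrow> redex t"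
  by (auto simp: redex_def)

lemma redexE:
  assumes "redex t"
  obtains t' where "root_step t t'"
  using assms by (auto simp: redex_def)

inductive par :: "'s::{semiring_0, monoid_mult} trm \<Rightarrow> 's trm \<Rightarrow> bool" where
  par_layer: "layer par t t' \<Longrightarrow> par t t'"
| par_root: "redex t \<Longrightarrow> layer par t t' \<Longrightarrow> root_step t' u \<Longrightarrow> par t u"

section \<open>Parallel steps lie between one step and many steps\<close>

lemmas par_congs = layer.intros[of par, THEN par_layer]

lemma par_refl [simp, intro]: "par t t"
  by (induction t) (auto intro: par_congs)

lemma root_step_imp_par: "root_step t t' \<Longrightarrow> par t t'"
  by (rule par_root[OF _ layer_refl]) (auto simp: redex_def)

lemma step_imp_par: "step t t' \<Longrightarrow> par t t'"
  by (induction rule: step.induct) (auto intro: par_congs root_step_imp_par)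

lemma rtranclp_map: "R\<^sup>*\<^sup>* x y \<Longrightarrow> (\<And>x y. R x y \<Longrightarrow> S (f x) (f y)) \<Longrightarrow> S\<^sup>*\<^sup>* (f x) (f y)"
  by (induction rule: rtranclp_induct) (auto intro: rtranclp.rtrancl_into_rtrancl)

text \<open>The immediate subterms are reduced one after the other, from left to right.\<close>

lemma layer_steps_imp_steps: "layer step\<^sup>*\<^sup>* t t' \<Longrightarrow> step\<^sup>*\<^sup>* t t'"
proof (induction rule: layer.induct)
  case (2 t t' u u')
  have "step\<^sup>*\<^sup>* (Sum t u) (Sum t' u)"
    using 2(1) by (rule rtranclp_map) (rule step.intros)
  also have "step\<^sup>*\<^sup>* \<dots> (Sum t' u')"
    using 2(2) by (rule rtranclp_map) (rule step.intros)
  finally show ?case .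
next
  case (3 t t' a)
  then show ?case by (rule rtranclp_map) (rule step.intros)
next
  case (5 t t' u u')
  have "step\<^sup>*\<^sup>* (ElimOne t u) (ElimOne t' u)"
    using 5(1) by (rule rtranclp_map) (rule step.intros)
  also have "step\<^sup>*\<^sup>* \<dots> (ElimOne t' u')"
    using 5(2) by (rule rtranclp_map) (rule step.intros)
  finally show ?case .
next
  case (6 t t' A)
  then show ?case by (rule rtranclp_map) (rule step.intros)
next
  case (7 t t' u u')
  have "step\<^sup>*\<^sup>* (App t u) (App t' u)"
    using 7(1) by (rule rtranclp_map) (rule step.intros)
  also have "step\<^sup>*\<^sup>* \<dots> (App t' u')"
    using 7(2) by (rule rtranclp_map) (rule step.intros)
  finally show ?case .
next
  case (8 t t' u u')
  have "step\<^sup>*\<^sup>* (Tens t u) (Tens t' u)"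
    using 8(1) by (rule rtranclp_map) (rule step.intros)
  also have "step\<^sup>*\<^sup>* \<dots> (Tens t' u')"
    using 8(2) by (rule rtranclp_map) (rule step.intros)
  finally show ?case .
next
  case (9 t t' u u' A B)
  have "step\<^sup>*\<^sup>* (ElimTensor t A B u) (ElimTensor t' A B u)"
    using 9(1) by (rule rtranclp_map) (rule step.intros)
  also have "step\<^sup>*\<^sup>* \<dots> (ElimTensor t' A B u')"
    using 9(2) by (rule rtranclp_map) (rule step.intros)
  finally show ?case .
next
  case (11 t t')
  then show ?case by (rule rtranclp_map) (rule step.intros)
next
  case (12 t t' u u')
  have "step\<^sup>*\<^sup>* (Tuple t u) (Tuple t' u)"
    using 12(1) by (rule rtranclp_map) (rule step.intros)
  also have "step\<^sup>*\<^sup>* \<dots> (Tuple t' u')"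
    using 12(2) by (rule rtranclp_map) (rule step.intros)
  finally show ?case .
next
  case (13 t t' u u' A)
  have "step\<^sup>*\<^sup>* (ElimWith1 t A u) (ElimWith1 t' A u)"
    using 13(1) by (rule rtranclp_map) (rule step.intros)
  also have "step\<^sup>*\<^sup>* \<dots> (ElimWith1 t' A u')"
    using 13(2) by (rule rtranclp_map) (rule step.intros)
  finally show ?case .
next
  case (14 t t' u u' A)
  have "step\<^sup>*\<^sup>* (ElimWith2 t A u) (ElimWith2 t' A u)"
    using 14(1) by (rule rtranclp_map) (rule step.intros)
  also have "step\<^sup>*\<^sup>* \<dots> (ElimWith2 t' A u')"
    using 14(2) by (rule rtranclp_map) (rule step.intros)
  finally show ?case .
next
  case (15 t t')
  then show ?case by (rule rtranclp_map) (rule step.intros)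
next
  case (16 t t')
  then show ?case by (rule rtranclp_map) (rule step.intros)
next
  case (17 t t' u u' v v' A B)
  have "step\<^sup>*\<^sup>* (ElimPlus t A u B v) (ElimPlus t' A u B v)"
    using 17(1) by (rule rtranclp_map) (rule step.intros)
  also have "step\<^sup>*\<^sup>* \<dots> (ElimPlus t' A u' B v)"
    using 17(2) by (rule rtranclp_map) (rule step.intros)
  also have "step\<^sup>*\<^sup>* \<dots> (ElimPlus t' A u' B v')"
    using 17(3) by (rule rtranclp_map) (rule step.intros)
  finally show ?case .
next
  case (18 t t')
  then show ?case by (rule rtranclp_map) (rule step.intros)
next
  case (19 t t' u u' A)
  have "step\<^sup>*\<^sup>* (ElimBang t A u) (ElimBang t' A u)"
    using 19(1) by (rule rtranclp_map) (rule step.intros)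
  also have "step\<^sup>*\<^sup>* \<dots> (ElimBang t' A u')"
    using 19(2) by (rule rtranclp_map) (rule step.intros)
  finally show ?case .
next
  case (20 t t')
  then show ?case by (rule rtranclp_map) (rule step.intros)
next
  case (21 t t' A)
  then show ?case by (rule rtranclp_map) (rule step.intros)
qed simp_all

lemma par_imp_steps: "par t t' \<Longrightarrow> step\<^sup>*\<^sup>* t t'"
proof (induction rule: par.induct)
  case (par_layer t t')
  \<comment> \<open>The induction hypothesis pairs \<open>par\<close> with the claim at each
    subterm; monotonicity keeps the claim alone.\<close>
  then have "layer step\<^sup>*\<^sup>* t t'"
    using layer_mono[of "\<lambda>x y. par x y \<and> step\<^sup>*\<^sup>* x y" "step\<^sup>*\<^sup>*"] by blast
  then show ?case by (rule layer_steps_imp_steps)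
next
  case (par_root t t' u)
  then have "layer step\<^sup>*\<^sup>* t t'"
    using layer_mono[of "\<lambda>x y. par x y \<and> step\<^sup>*\<^sup>* x y" "step\<^sup>*\<^sup>*"] by blast
  then have "step\<^sup>*\<^sup>* t t'" by (rule layer_steps_imp_steps)
  with par_root show ?case by (auto intro: step.root rtranclp.rtrancl_into_rtrancl)
qed

section \<open>Parallel reduction under renaming and substitution\<close>

lemma root_step_ren: "root_step t t' \<Longrightarrow> root_step (trm_ren r t) (trm_ren r t')"
  by (induction rule: root_step.induct)
    (simp_all add: trm_ren_inst1 trm_ren_inst2 trm_ren_inst_form root_step.intros)

lemma root_step_form_subst:
  "root_step t t' \<Longrightarrow> root_step (trm_form_subst f t) (trm_form_subst f t')"
  by (induction rule: root_step.induct)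
    (simp_all add: trm_form_subst_inst1 trm_form_subst_inst2 trm_form_subst_inst_form
      root_step.intros)

lemma root_step_subst: "root_step t t' \<Longrightarrow> root_step (trm_subst s t) (trm_subst s t')"
  by (induction rule: root_step.induct)
    (simp_all add: trm_subst_inst1 trm_subst_inst2 trm_subst_inst_form root_step.intros)

text \<open>Renaming maps redexes to redexes and contracta to contracta, so both demands of
  \<open>par_root\<close> survive.\<close>

lemma par_ren: "par t t' \<Longrightarrow> par (trm_ren r t) (trm_ren r t')"
proof (induction arbitrary: r rule: par.induct)
  case (par_layer t t')
  then show ?case by (auto elim!: layer.cases intro!: par_congs)
next
  case (par_root t t' u)
  from par_root.IH have "layer par (trm_ren r t) (trm_ren r t')"
    by (auto elim!: layer.cases intro!: layer.intros)
  with par_root.hyps show ?case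
    by (meson par.par_root redexE redexI root_step_ren)
qed

lemma par_form_subst: "par t t' \<Longrightarrow> par (trm_form_subst f t) (trm_form_subst f t')"
proof (induction arbitrary: f rule: par.induct)
  case (par_layer t t')
  then show ?case by (auto elim!: layer.cases intro!: par_congs)
next
  case (par_root t t' u)
  from par_root.IH have "layer par (trm_form_subst f t) (trm_form_subst f t')"
    by (auto elim!: layer.cases intro!: layer.intros)
  with par_root.hyps show ?case
    by (meson par.par_root redexE redexI root_step_form_subst)
qed

definition par_env :: "(nat \<Rightarrow> 's::{semiring_0, monoid_mult} trm) \<Rightarrow> (nat \<Rightarrow> 's trm) \<Rightarrow> bool" where
  "par_env s s' \<longleftrightarrow> (\<forall>n. par (s n) (s' n))"

lemma par_env_up: "par_env s s' \<Longrightarrow> par_env (trm_up s) (trm_up s')"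
  by (auto simp: par_env_def intro: par_ren split: nat.split)

lemma par_env_form_subst:
  "par_env s s' \<Longrightarrow> par_env (\<lambda>n. trm_form_subst f (s n)) (\<lambda>n. trm_form_subst f (s' n))"
  by (auto simp: par_env_def intro: par_form_subst)

text \<open>The relation in the first premise is what induction on \<open>par\<close> supplies.
  Variables are excluded because their images \<open>s n\<close> and \<open>s' n\<close> are related
  by \<open>par\<close>, not necessarily by \<open>layer par\<close>.\<close>

lemma layer_subst:
  assumes "layer (\<lambda>x y. par x y \<and> (\<forall>s s'. par_env s s' \<longrightarrow> par (trm_subst s x) (trm_subst s' y))) t t'"
    and "par_env s s'" and "\<And>n. t \<noteq> Var n"
  shows "layer par (trm_subst s t) (trm_subst s' t')"
  using assms(1)
  by cases (use assms(2,3) in \<open>auto intro!: layer.intros, (blast intro: par_env_up par_env_form_subst)+\<close>)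

lemma par_subst: "par t t' \<Longrightarrow> par_env s s' \<Longrightarrow> par (trm_subst s t) (trm_subst s' t')"
proof (induction arbitrary: s s' rule: par.induct)
  case (par_layer t t')
  show ?case
  proof (cases "\<exists>n. t = Var n")
    case True
    then show ?thesis using par_layer by (auto simp: par_env_def elim!: layer_elims)
  next
    case False
    then have "layer par (trm_subst s t) (trm_subst s' t')"
      by (intro layer_subst[OF _ par_layer(2)]) (use par_layer(1) in auto)
    then show ?thesis by (rule par.par_layer)
  qed
next
  case (par_root t t' u)
  \<comment> \<open>A redex is never a variable.\<close>
  have "layer par (trm_subst s t) (trm_subst s' t')"
    by (rule layer_subst[OF _ par_root.prems])
      (use par_root.IH par_root.hyps(1) in \<open>auto elim!: redexE elim: root_step.cases\<close>)
  with par_root.hyps show ?case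
    by (meson par.par_root redexE redexI root_step_subst)
qed

lemma par_inst1: "par u u' \<Longrightarrow> par t t' \<Longrightarrow> par (inst1 u t) (inst1 u' t')"
  unfolding inst1_def by (rule par_subst) (auto simp: par_env_def split: nat.split)

lemma par_inst2: "par u u' \<Longrightarrow> par v v' \<Longrightarrow> par t t' \<Longrightarrow> par (inst2 u v t) (inst2 u' v' t')"
  unfolding inst2_def by (rule par_subst) (auto simp: par_env_def split: nat.split)

lemma par_inst_form: "par t t' \<Longrightarrow> par (inst_form A t) (inst_form A t')"
  unfolding inst_form_def by (rule par_form_subst)

section \<open>Common parallel reducts: the triangle property\<close>

inductive_cases root_step_elims:
  "root_step (Var n) x"
  "root_step (Sum t u) x"
  "root_step (Scal a t) x"
  "root_step (Star a) x"
  "root_step (ElimOne t u) x"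
  "root_step (Lam A t) x"
  "root_step (App t u) x"
  "root_step (Tens t u) x"
  "root_step (ElimTensor t A B u) x"
  "root_step Unit x"
  "root_step (ElimZero t) x"
  "root_step (Tuple t u) x"
  "root_step (ElimWith1 t A u) x"
  "root_step (ElimWith2 t A u) x"
  "root_step (InL t) x"
  "root_step (InR t) x"
  "root_step (ElimPlus t A u B v) x"
  "root_step (Bang t) x"
  "root_step (ElimBang t A u) x"
  "root_step (TLam t) x"
  "root_step (TApp t A) x"

lemma par_nonredex: "\<not> redex t \<Longrightarrow> par t t' \<longleftrightarrow> layer par t t'"
  by (auto elim: par.cases intro: par_layer)

text \<open>No rule contracts a term headed by one of these constructors, so parallel steps preserve
  the head on which an enclosing redex depends.\<close>

lemma par_intros_eq [simp]:
  "par (Star a) x \<longleftrightarrow> x = Star a"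
  "par (Lam A t) x \<longleftrightarrow> (\<exists>t'. x = Lam A t' \<and> par t t')"
  "par (Tens t u) x \<longleftrightarrow> (\<exists>t' u'. x = Tens t' u' \<and> par t t' \<and> par u u')"
  "par Unit x \<longleftrightarrow> x = Unit"
  "par (Tuple t u) x \<longleftrightarrow> (\<exists>t' u'. x = Tuple t' u' \<and> par t t' \<and> par u u')"
  "par (InL t) x \<longleftrightarrow> (\<exists>t'. x = InL t' \<and> par t t')"
  "par (InR t) x \<longleftrightarrow> (\<exists>t'. x = InR t' \<and> par t t')"
  "par (Bang t) x \<longleftrightarrow> (\<exists>t'. x = Bang t' \<and> par t t')"
  "par (TLam t) x \<longleftrightarrow> (\<exists>t'. x = TLam t' \<and> par t t')"
  by (subst par_nonredex; auto simp: redex_def elim!: layer_elims root_step_elims intro: layer.intros)+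

text \<open>The second alternative records the old redex, which typing can refute below
  \<open>ElimTensor\<close> and \<open>ElimPlus\<close>, and the contraction, whose result has a
  head that makes neither elimination a redex.\<close>

lemma par_SumE:
  assumes "par (Sum t u) x"
  obtains t' u' where "x = Sum t' u'" "par t t'" "par u u'"
  | t' u' where "redex (Sum t u)" "root_step (Sum t' u') x"
  using assms by cases (auto elim!: layer_elims)

lemma par_ScalE:
  assumes "par (Scal a t) x"
  obtains t' where "x = Scal a t'" "par t t'"
  | t' where "redex (Scal a t)" "root_step (Scal a t') x"
  using assms by cases (auto elim!: layer_elims)

text \<open>Since \<open>u\<close> is still contracted at the root, the inner steps cannot have
  destroyed the pattern, and the same rule applies on both sides. What remains is congruence and
  compatibility of \<open>par\<close> with instantiation.\<close>

lemma root_step_par: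
  assumes "root_step t t'" "layer par t u" "root_step u u'"
  shows "par t' u'"
  using assms(1)
  by cases
    (use assms(2,3) in \<open>auto elim!: layer_elims root_step_elims par_SumE par_ScalE
       intro!: par_congs par_inst1 par_inst2 par_inst_form\<close>)

text \<open>
  This is the use of typing: without it \<^verbatim>\<open>ElimTensor (Sum (Star a) (Star b)) A B v\<close> is a redex, but
  contracting the sum destroys it.
\<close>

lemma redex_layer:
  assumes "has_ty G t A" "redex t" "layer par t t'"
  shows "redex t'"
proof -
  from assms(2) obtain u where "root_step t u" unfolding redex_def by blast
  then show ?thesis
    by cases
      (use assms(1,3) in \<open>auto elim!: layer_elims has_ty_elims par_SumE par_ScalE redexE
         elim: root_step_elims intro: root_step.intros[THEN redexI]\<close>)
qed

text \<open>The triangle property of Takahashi's complete development, taken as a relation so that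
  no development function has to be defined.\<close>

definition par_max :: "'s::{semiring_0, monoid_mult} trm \<Rightarrow> 's trm \<Rightarrow> bool" where
  "par_max t d \<longleftrightarrow> (\<forall>t'. par t t' \<longrightarrow> par t' d)"

lemma layer_triangle:
  assumes "layer par t t'" "layer par_max t m"
  shows "layer par t' m"
  using assms(1)
  by cases (use assms(2) in \<open>auto simp: par_max_def elim!: layer_elims intro: layer.intros\<close>)

text \<open>Let \<open>m\<close> collect maximal reducts of the immediate subterms. If
  \<open>t\<close> is no redex, \<open>m\<close> itself is maximal; otherwise the contractum of
  \<open>m\<close> is.\<close>

lemma triangle_root:
  assumes "has_ty G t A" "\<exists>m. layer par_max t m"
  shows "\<exists>d. par_max t d"
proof -
  from assms(2) obtain m where m: "layer par_max t m" ..
  show ?thesis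
  proof (cases "redex t")
    case False
    then show ?thesis
      unfolding par_max_def using m layer_triangle par_layer par_nonredex by blast
  next
    case True
    \<comment> \<open>Reflexivity makes \<open>m\<close> a reduct of \<open>t\<close> below the
      root, so by typing \<open>m\<close> is still a redex.\<close>
    have "layer par t m" using layer_triangle[OF layer_refl m] by blast
    then obtain d where d: "root_step m d"
      using redex_layer[OF assms(1) True] by (auto elim: redexE)
    have "par t' d" if "par t t'" for t'
      using that
    proof cases
      \<comment> \<open>The root redex was left alone: by typing it survives in \<open>t'\<close>,
        and it is contracted on the way to \<open>d\<close>.\<close>
      case par_layer
      then show ?thesis
        using d m True assms(1) layer_triangle par_root redex_layer by blast
    next
      \<comment> \<open>The root redex was contracted: \<open>u\<close> reduces to \<open>m\<close>
        below the root, and the contracta of \<open>u\<close> and \<open>m\<close> are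
        compared.\<close>
      case (par_root u)
      then show ?thesis using d m layer_triangle root_step_par by blast
    qed
    then show ?thesis unfolding par_max_def by blast
  qed
qed

text \<open>Inverting the typing types the immediate subterms, in contexts that vary below binders.
  A variable has no subterms, hence the optional elimination.\<close>

lemma has_ty_par_max: "has_ty G t A \<Longrightarrow> \<exists>d. par_max t d"
proof (induction t arbitrary: G A)
qed (rule triangle_root, assumption, (elim has_ty_elims)?, blast intro: layer.intros)+

section \<open>Confluence\<close>

lemma has_ty_steps: "step\<^sup>*\<^sup>* t t' \<Longrightarrow> has_ty G t A \<Longrightarrow> has_ty G t' A"
  by (induction rule: rtranclp_induct) (auto intro: has_ty_step)

text \<open>The maximal reduct of \<open>t\<close> closes the first square; subject reduction types
  \<open>t'\<close> for the remaining ones.\<close>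

lemma par_strip:
  assumes "par\<^sup>*\<^sup>* t u" "has_ty G t A" "par t v"
  shows "\<exists>w. par u w \<and> par\<^sup>*\<^sup>* v w"
  using assms
proof (induction arbitrary: v rule: converse_rtranclp_induct)
  case base
  then show ?case by blast
next
  case (step t t')
  obtain d where d: "par_max t d" using has_ty_par_max step.prems(1) by blast
  have "has_ty G t' A" using has_ty_steps par_imp_steps step.hyps(1) step.prems(1) by blast
  moreover have "par t' d" using d step.hyps(1) by (simp add: par_max_def)
  ultimately obtain w where w: "par u w" "par\<^sup>*\<^sup>* d w" using step.IH by blast
  have "par v d" using d step.prems(2) by (simp add: par_max_def)
  with w show ?case by (blast intro: converse_rtranclp_into_rtranclp)
qed

text \<open>Strips are stacked along the reduction to \<open>v\<close>, each moving the other
  reduction on by one parallel step.\<close>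

lemma par_confluent:
  assumes "par\<^sup>*\<^sup>* t v" "par\<^sup>*\<^sup>* t u" "has_ty G t A"
  shows "\<exists>w. par\<^sup>*\<^sup>* u w \<and> par\<^sup>*\<^sup>* v w"
  using assms
proof (induction arbitrary: u rule: converse_rtranclp_induct)
  case base
  then show ?case by blast
next
  case (step t t')
  obtain w where w: "par u w" "par\<^sup>*\<^sup>* t' w" using par_strip step.hyps(1) step.prems by blast
  have "has_ty G t' A" using has_ty_steps par_imp_steps step.hyps(1) step.prems(2) by blast
  then obtain x where "par\<^sup>*\<^sup>* w x" "par\<^sup>*\<^sup>* v x" using w(2) step.IH by blast
  with w(1) show ?case by (blast intro: converse_rtranclp_into_rtranclp)
qed

text \<open>Holds because \<open>par\<close> contains \<open>step\<close> and is contained in its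
  closure.\<close>

lemma par_rtranclp: "par\<^sup>*\<^sup>* = step\<^sup>*\<^sup>*"
proof (intro ext iffI)
  show "step\<^sup>*\<^sup>* t u" if "par\<^sup>*\<^sup>* t u" for t u :: "'s::{semiring_0, monoid_mult} trm"
    using that by (induction rule: rtranclp_induct) (auto dest: par_imp_steps)
  show "par\<^sup>*\<^sup>* t u" if "step\<^sup>*\<^sup>* t u" for t u :: "'s::{semiring_0, monoid_mult} trm"
    using that by (rule rtranclp_mono[THEN predicate2D, rotated]) (auto intro: step_imp_par)
qed

theorem theorem2:
  fixes t u1 u2 :: "'s::{semiring_0, monoid_mult} trm"
  assumes "well_formed t"
    and "step\<^sup>*\<^sup>* t u1"
    and "step\<^sup>*\<^sup>* t u2"
  shows "\<exists>v. step\<^sup>*\<^sup>* u1 v \<and> step\<^sup>*\<^sup>* u2 v"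
proof -
  obtain U G A where typed: "typed U G t A"
    using assms(1) unfolding well_formed_def by blast
  \<comment> \<open>Passes to a total context, the form of typing on which the confluence of
    \<open>par\<close> rests.\<close>
  obtain H where "fits H U G" using typed_disjoint[OF typed] by (rule disj_fits)
  then have "has_ty H t A" using typed by (rule typed_imp_has_ty[rotated])
  then show ?thesis
    using par_confluent[of t u2 u1] assms(2,3) unfolding par_rtranclp by blast
qed

end
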